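(* For every integer $n\ge 0$, the polytope $A^\vee_3\oplus (A^\vee_1)^{\oplus n}$ is a CL-polytope.
   Context: $A_d=\mathrm{conv}(\{\pm(e_i+e_{i+1}+\dots+e_j):1\le i\le j\le d\})\subset\mathbb{R}^d$; $Q^\vee=\{x:\langle x,y\rangle\ge -1\ \forall y\in Q\}$ is the polar dual. For polytopes $Q_1\subset\mathbb{R}^{d_1},Q_2\subset\mathbb{R}^{d_2}$ containing the origin, $Q_1\oplus Q_2=\mathrm{conv}((Q_1\times\{0\})\cup(\{0\}\times Q_2))\subset\mathbb{R}^{d_1+d_2}$, and $Q^{\oplus n}$ is the $n$-fold free sum of $Q$ with itself. For an integral full-dimensional polytope $Q\subset\mathbb{R}^d$, $E_Q(k)=\#(kQ\cap\mathbb{Z}^d)$ is its Ehrhart polynomial. A reflexive polytope is CL if all roots of its Ehrhart polynomial lie on the line $\mathrm{Re}(z)=-\tfrac12$ in $\mathbb{C}$. *)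

theory Defs
  imports "HOL-Analysis.Analysis" "HOL-Analysis.Finite_Function_Topology"
    "HOL-Computational_Algebra.Polynomial"
begin

text \<open>
  The ambient dimension varies inside the statement, so all the spaces \<open>R^d\<close> live in one type:
  \<open>R^d\<close> is the set of finitely supported vectors with support in \<open>{1..d}\<close>.  The type is a
  real normed vector space, and the library's norm induces the usual topology on each \<open>R^d\<close>.
\<close>

type_synonym vec = "nat \<Rightarrow>\<^sub>0 real"

abbreviation coord :: "vec \<Rightarrow> nat \<Rightarrow> real" where
  "coord \<equiv> Poly_Mapping.lookup"

abbreviation unit_vec :: "nat \<Rightarrow> vec" where
  "unit_vec i \<equiv> Poly_Mapping.single i 1"

definition Rspace :: "nat \<Rightarrow> vec set" where
  "Rspace d = {x. Poly_Mapping.keys x \<subseteq> {1..d}}"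

definition lattice :: "nat \<Rightarrow> vec set" where
  "lattice d = {x \<in> Rspace d. \<forall>i. coord x i \<in> \<int>}"

definition inner_prod :: "nat \<Rightarrow> vec \<Rightarrow> vec \<Rightarrow> real" where
  "inner_prod d x y = (\<Sum>i=1..d. coord x i * coord y i)"

definition polar_dual :: "nat \<Rightarrow> vec set \<Rightarrow> vec set" where
  "polar_dual d Q = {x \<in> Rspace d. \<forall>y\<in>Q. inner_prod d x y \<ge> -1}"

definition A_polytope :: "nat \<Rightarrow> vec set" where
  "A_polytope d = convex hull
     (\<Union>(i, j) \<in> {(i, j). 1 \<le> i \<and> i \<le> j \<and> j \<le> d}.
        {(\<Sum>k=i..j. unit_vec k), - (\<Sum>k=i..j. unit_vec k)})"

text \<open>
  \<open>shift d\<close> moves coordinate \<open>i\<close> to coordinate \<open>d + i\<close>.  It embeds \<open>R^e\<close> as \<open>{0} \<times> R^e\<close> in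
  \<open>R^(d+e)\<close>; the embedding of \<open>R^d\<close> as \<open>R^d \<times> {0}\<close> is the inclusion.
\<close>

definition shift :: "nat \<Rightarrow> vec \<Rightarrow> vec" where
  "shift d x = (\<Sum>i \<in> Poly_Mapping.keys x. Poly_Mapping.single (d + i) (coord x i))"

text \<open>The dimension argument of \<open>free_sum\<close> is that of the first summand.\<close>

definition free_sum :: "nat \<Rightarrow> vec set \<Rightarrow> vec set \<Rightarrow> vec set" where
  "free_sum d Q1 Q2 = convex hull (Q1 \<union> shift d ` Q2)"

text \<open>For \<open>Q\<close> in \<open>R^d\<close>, the \<open>n\<close>-fold free sum lies in \<open>R^(n * d)\<close>; the empty one is \<open>R^0\<close>.\<close>

primrec free_sum_power :: "nat \<Rightarrow> vec set \<Rightarrow> nat \<Rightarrow> vec set" where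
  "free_sum_power d Q 0 = {0}"
| "free_sum_power d Q (Suc n) = free_sum (n * d) (free_sum_power d Q n) Q"

definition integral_polytope :: "nat \<Rightarrow> vec set \<Rightarrow> bool" where
  "integral_polytope d Q \<longleftrightarrow> (\<exists>V. finite V \<and> V \<subseteq> lattice d \<and> Q = convex hull V)"

text \<open>
  The interior is taken relative to \<open>R^d\<close>; in particular a reflexive polytope is full-dimensional.
\<close>

definition reflexive :: "nat \<Rightarrow> vec set \<Rightarrow> bool" where
  "reflexive d Q \<longleftrightarrow> integral_polytope d Q \<and> 0 \<in> top_of_set (Rspace d) interior_of Q
     \<and> integral_polytope d (polar_dual d Q)"

definition lattice_count :: "nat \<Rightarrow> vec set \<Rightarrow> nat \<Rightarrow> nat" where
  "lattice_count d Q k = card ((\<lambda>x. real k *\<^sub>R x) ` Q \<inter> lattice d)"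

definition is_ehrhart_poly :: "nat \<Rightarrow> vec set \<Rightarrow> complex poly \<Rightarrow> bool" where
  "is_ehrhart_poly d Q p \<longleftrightarrow> (\<forall>k. poly p (of_nat k) = of_nat (lattice_count d Q k))"

lemma is_ehrhart_poly_unique:
  assumes "is_ehrhart_poly d Q p" "is_ehrhart_poly d Q q"
  shows "p = q"
proof (rule ccontr)
  assume "p \<noteq> q"
  then have "finite {z. poly (p - q) z = 0}"
    by (intro poly_roots_finite) simp
  moreover have "range of_nat \<subseteq> {z. poly (p - q) z = 0}"
    using assms by (auto simp: is_ehrhart_poly_def)
  moreover have "infinite (range (of_nat :: nat \<Rightarrow> complex))"
    by (intro range_inj_infinite inj_of_nat)
  ultimately show False
    using finite_subset by blast
qed

text \<open>
  Since the Ehrhart polynomial is unique, the existential below only selects it; its existence is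
  part of the claim.
\<close>

definition CL_polytope :: "nat \<Rightarrow> vec set \<Rightarrow> bool" where
  "CL_polytope d Q \<longleftrightarrow> reflexive d Q
     \<and> (\<exists>p. is_ehrhart_poly d Q p \<and> (\<forall>z. poly p z = 0 \<longrightarrow> Re z = - 1 / 2))"

end

theory Submission
  imports Defs "HOL-Library.Set_Algebras"
begin

text \<open>
  The free sum with \<open>A_1\<close> dual \<open>= [-1, 1]\<close> is a bipyramid. Slicing it shows that each such step
  multiplies the Ehrhart series by \<open>(1 + t) / (1 - t)\<close>. The dual of \<open>A_3\<close> has Ehrhart polynomial
  \<open>(k + 1)^4 - k^4\<close>, hence \<open>h\<^sup>*\<close>-polynomial \<open>(1 + t) (1 + 10 t + t\<^sup>2)\<close>. Writing
  \<open>1 + 10 t + t\<^sup>2 = 3 (1 + t)\<^sup>2 - 2 (1 - t)\<^sup>2\<close> gives the Ehrhart polynomial \<open>3 C\<^sub>n\<^sub>+\<^sub>3 - 2 C\<^sub>n\<^sub>+\<^sub>1\<close>, where \<open>C\<^sub>m\<close> is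
  the Ehrhart polynomial of the \<open>m\<close>-dimensional cross-polytope. The three-term recurrence of \<open>C\<^sub>m\<close>
  turns this into a combination of \<open>(2 z + 1) C\<^sub>n\<^sub>+\<^sub>2\<close> and \<open>C\<^sub>n\<^sub>+\<^sub>1\<close> with nonnegative coefficients. By
  induction along the recurrence the real part of \<open>C\<^sub>m\<^sub>+\<^sub>1(z) / C\<^sub>m(z)\<close> has the sign of
  \<open>Re (2 z + 1)\<close>, so no root lies off the line \<open>Re z = - 1 / 2\<close>.
\<close>

subsection \<open>Cross-polytope polynomials\<close>

text \<open>The polynomial with series \<open>(1 + t)^m / (1 - t)^(m + 1)\<close>. The recurrence is
  taken as the definition because it locates the roots; the difference equation that matches lattice
  counts is derived from it.\<close>

fun cross_poly :: "nat \<Rightarrow> complex poly" where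
  "cross_poly 0 = 1"
| "cross_poly (Suc 0) = [:1, 2:]"
| "cross_poly (Suc (Suc m)) = smult (1 / of_nat (m + 2))
     ([:1, 2:] * cross_poly (Suc m) + smult (of_nat (m + 1)) (cross_poly m))"

lemma poly_cross_poly_rec:
  "(of_nat m + 2) * poly (cross_poly (Suc (Suc m))) z =
   (2 * z + 1) * poly (cross_poly (Suc m)) z + (of_nat m + 1) * poly (cross_poly m) z"
proof -
  have "(of_nat m + 2 :: complex) \<noteq> 0"
    using of_nat_neq_0[of "Suc m", where 'a = complex] by (simp add: add.commute)
  then show ?thesis by (simp add: field_simps)
qed

declare cross_poly.simps(3) [simp del]

lemma poly_cross_poly_0: "poly (cross_poly m) 0 = 1"
proof (induction m rule: cross_poly.induct)
  case (3 m)
  have "(of_nat m + 2) * poly (cross_poly (Suc (Suc m))) 0 = (of_nat m + 2)"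
    using 3 by (simp add: poly_cross_poly_rec)
  moreover have "(of_nat m + 2 :: complex) \<noteq> 0"
    using of_nat_neq_0[of "Suc m", where 'a = complex] by (simp add: add.commute)
  ultimately show ?case by simp
qed simp_all

text \<open>Coefficient form of the fact that passing from \<open>m\<close> to \<open>m + 1\<close>
  multiplies the series by \<open>(1 + t) / (1 - t)\<close>.\<close>

lemma poly_cross_poly_step:
  defines "D \<equiv> \<lambda>m z. poly (cross_poly m) (z + 1) - poly (cross_poly m) z"
    and "E \<equiv> \<lambda>m z. poly (cross_poly m) (z + 1) + poly (cross_poly m) z"
  shows "D (Suc m) z = E m z"
proof -
  \<comment> \<open>Writing the factors \<open>2 * z + 3\<close> and \<open>2 * z + 1\<close> at
    \<open>z + 1\<close> and \<open>z\<close> as \<open>(2 * z + 2)\<close> plus and minus 1 couples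
    the recurrences of \<open>D\<close> and \<open>E\<close>.\<close>
  have recD: "(of_nat m + 2) * D (Suc (Suc m)) z =
      (2 * z + 2) * D (Suc m) z + E (Suc m) z + (of_nat m + 1) * D m z" for m
    unfolding D_def E_def right_diff_distrib poly_cross_poly_rec by (simp add: algebra_simps)
  have recE: "(of_nat m + 2) * E (Suc (Suc m)) z =
      (2 * z + 2) * E (Suc m) z + D (Suc m) z + (of_nat m + 1) * E m z" for m
    unfolding D_def E_def distrib_left[of "of_nat m + 2"] poly_cross_poly_rec
    by (simp add: algebra_simps)
  \<comment> \<open>The second conjunct lets the induction close: inserted into \<open>recD\<close>,
    it cancels \<open>D m z\<close> and leaves \<open>m + 2\<close> copies of
    \<open>E (Suc m) z\<close>.\<close>
  have "D (Suc m) z = E m z \<and>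
      (2 * z + 2) * D (Suc m) z = (of_nat m + 1) * (E (Suc m) z - D m z)"
  proof (induction m)
    case 0
    show ?case by (simp add: D_def E_def algebra_simps)
  next
    case (Suc m)
    have nz: "(of_nat m + 2 :: complex) \<noteq> 0"
      using of_nat_neq_0[of "Suc m", where 'a = complex] by (simp add: add.commute)
    have "(of_nat m + 2) * D (Suc (Suc m)) z = (of_nat m + 2) * E (Suc m) z"
      unfolding recD using conjunct2[OF Suc] by (simp only:) (simp add: algebra_simps)
    then have 1: "D (Suc (Suc m)) z = E (Suc m) z"
      using nz by simp
    moreover have "(2 * z + 2) * D (Suc (Suc m)) z =
        (of_nat m + 2) * (E (Suc (Suc m)) z - D (Suc m) z)"
      unfolding right_diff_distrib recE 1 using Suc by (simp add: algebra_simps)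
    ultimately show ?case by (simp add: add.commute)
  qed
  then show ?thesis ..
qed

section \<open>Location of the roots\<close>

lemma Re_inverse_mult_pos:
  assumes "0 < a * Re z"
  shows "0 < a * Re (inverse z)"
proof -
  have "z \<noteq> 0" using assms by auto
  then have "0 < (Re z)\<^sup>2 + (Im z)\<^sup>2" by (simp add: complex_neq_0)
  then show ?thesis using assms by simp
qed

text \<open>Dividing the recurrence by the middle term writes the next ratio as a positive
  combination of \<open>2 * z + 1\<close> and the inverse of the current ratio, and inversion keeps
  the sign of the real part. The factor \<open>Re (2 * z + 1)\<close> treats both half-planes at
  once.\<close>

lemma cross_poly_ratio:
  assumes "Re (2 * z + 1) \<noteq> 0"
  shows "poly (cross_poly m) z \<noteq> 0 \<and>
    0 < Re (2 * z + 1) * Re (poly (cross_poly (Suc m)) z / poly (cross_poly m) z)"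
proof (induction m)
  case 0
  have "poly (cross_poly (Suc 0)) z / poly (cross_poly 0) z = 2 * z + 1"
    by (simp add: algebra_simps)
  then show ?case using assms by (auto simp: zero_less_mult_iff)
next
  case (Suc m)
  define w where "w = 2 * z + 1"
  define r where "r = poly (cross_poly (Suc m)) z / poly (cross_poly m) z"
  define r' where "r' = poly (cross_poly (Suc (Suc m))) z / poly (cross_poly (Suc m)) z"
  have r: "0 < Re w * Re r" and nz: "poly (cross_poly m) z \<noteq> 0"
    using Suc by (auto simp: r_def w_def)
  \<comment> \<open>A zero numerator would make \<open>r\<close>, hence the positive product,
    zero.\<close>
  have nz': "poly (cross_poly (Suc m)) z \<noteq> 0"
    using r by (auto simp: r_def)
  have "(of_nat m + 2) * r' = w + (of_nat m + 1) * inverse r"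
    using nz nz' poly_cross_poly_rec[of m z]
    by (simp add: r_def r'_def w_def divide_simps)
  then have "Re ((of_real (real m + 2)) * r') = Re (w + of_real (real m + 1) * inverse r)"
    by simp
  then have *: "(real m + 2) * Re r' = Re w + (real m + 1) * Re (inverse r)"
    by (simp only: Re_complex_of_real Im_complex_of_real times_complex.sel plus_complex.sel
      mult_zero_left diff_zero)
  have "0 < Re w * Re w" using assms by (auto simp: w_def zero_less_mult_iff)
  moreover have "0 < Re w * Re (inverse r)"
    using r by (rule Re_inverse_mult_pos)
  ultimately have "0 < Re w * Re w + (real m + 1) * (Re w * Re (inverse r))"
    by (intro add_pos_pos[OF _ mult_pos_pos]) simp_all
  also have "\<dots> = (real m + 2) * (Re w * Re r')"
    using arg_cong[OF *, of "\<lambda>t. Re w * t"] by (simp add: algebra_simps)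
  finally have "0 < Re w * Re r'"
    by (simp add: zero_less_mult_iff)
  then show ?case using nz' by (simp add: r'_def w_def)
qed

text \<open>The polynomial with series
  \<open>(1 + t)^(n + 1) * (1 + 10 * t + t^2) / (1 - t)^(n + 4)\<close>.\<close>

definition ehrhart_poly :: "nat \<Rightarrow> complex poly" where
  "ehrhart_poly n = smult 3 (cross_poly (n + 3)) - smult 2 (cross_poly (n + 1))"

text \<open>Eliminating the term of index \<open>n + 3\<close> leaves the coefficient
  \<open>3 * (n + 2) - 2 * (n + 3) = n\<close> at index \<open>n + 1\<close>; its sign is what the
  root argument rests on.\<close>

lemma poly_ehrhart_poly_rec:
  "(of_nat n + 3) * poly (ehrhart_poly n) z =
   3 * (2 * z + 1) * poly (cross_poly (n + 2)) z + of_nat n * poly (cross_poly (n + 1)) z"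
proof -
  have "(of_nat n + 3) * poly (cross_poly (n + 3)) z =
   (2 * z + 1) * poly (cross_poly (n + 2)) z + (of_nat n + 2) * poly (cross_poly (n + 1)) z"
    using poly_cross_poly_rec[of "Suc n" z] by (simp add: numeral_eq_Suc add.commute)
  then show ?thesis by (simp add: ehrhart_poly_def algebra_simps)
qed

text \<open>Off the line, dividing by \<open>cross_poly (n + 2)\<close> turns a root into
  \<open>3 * w + n / r = 0\<close>. Multiplied by \<open>Re w\<close>, the real part of the first
  term is positive and that of the second is nonnegative.\<close>

lemma ehrhart_poly_roots:
  assumes "poly (ehrhart_poly n) z = 0"
  shows "Re z = - 1 / 2"
proof (rule ccontr)
  assume "Re z \<noteq> - 1 / 2"
  then have nz: "Re (2 * z + 1) \<noteq> 0" by auto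
  define w where "w = 2 * z + 1"
  define r where "r = poly (cross_poly (n + 2)) z / poly (cross_poly (n + 1)) z"
  have r: "0 < Re w * Re r" and p: "poly (cross_poly (n + 1)) z \<noteq> 0"
    using cross_poly_ratio[OF nz, of "n + 1"] by (auto simp: r_def w_def)
  have p': "poly (cross_poly (n + 2)) z \<noteq> 0"
    using r by (auto simp: r_def)
  have "3 * w + of_nat n * inverse r = 0"
    using p p' poly_ehrhart_poly_rec[of n z] assms
    by (simp add: r_def w_def divide_simps)
  then have "Re (of_real 3 * w + of_real (real n) * inverse r) = 0"
    by simp
  then have "3 * Re w + real n * Re (inverse r) = 0"
    by (simp only: Re_complex_of_real Im_complex_of_real times_complex.sel plus_complex.sel
      mult_zero_left diff_zero zero_complex.sel)
  then have "3 * (Re w * Re w) + real n * (Re w * Re (inverse r)) = 0"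
    by (metis (no_types, opaque_lifting) distrib_left mult.left_commute mult_zero_right)
  moreover have "0 < Re w * Re w" using nz by (auto simp: w_def zero_less_mult_iff)
  moreover have "0 < Re w * Re (inverse r)"
    using r by (rule Re_inverse_mult_pos)
  ultimately show False
    by (smt (verit) mult_nonneg_nonneg of_nat_0_le_iff)
qed

section \<open>Values and difference equation of the Ehrhart polynomial\<close>

lemma poly_ehrhart_poly_0: "poly (ehrhart_poly n) 0 = 1"
  by (simp add: ehrhart_poly_def poly_cross_poly_0)

lemma poly_ehrhart_poly_step:
  "poly (ehrhart_poly (Suc n)) (z + 1) = poly (ehrhart_poly (Suc n)) z
     + poly (ehrhart_poly n) (z + 1) + poly (ehrhart_poly n) z"
  using poly_cross_poly_step[of "n + 3" z] poly_cross_poly_step[of "n + 1" z]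
  by (simp add: ehrhart_poly_def algebra_simps)

lemma poly_ehrhart_poly_base: "poly (ehrhart_poly 0) z = (z + 1) ^ 4 - z ^ 4"
  by (simp add: ehrhart_poly_def numeral_eq_Suc cross_poly.simps(3) field_simps)

text \<open>Telescoping the difference equation from the common value 1 at 0 yields the recursion
  that lattice counts of bipyramids satisfy.\<close>

lemma poly_ehrhart_poly_sum:
  "poly (ehrhart_poly (Suc n)) (of_nat k) =
   poly (ehrhart_poly n) (of_nat k) + 2 * (\<Sum>j<k. poly (ehrhart_poly n) (of_nat j))"
proof (induction k)
  case (Suc k)
  then show ?case
    using poly_ehrhart_poly_step[of n "of_nat k"] by (simp add: algebra_simps)
qed (simp add: poly_ehrhart_poly_0)

subsection \<open>Lattices, inner products and polar duals\<close>

lemma coord_scaleR [simp]: "coord (r *\<^sub>R x) i = r * coord x i"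
proof -
  have "finite {i. r *\<^sub>R coord x i \<noteq> 0}"
    by (rule finite_subset[OF _ finite_keys[of x]]) (auto simp: in_keys_iff)
  then show ?thesis by (simp add: scaleR_poly_mapping_def lookup_Abs_poly_mapping)
qed

lemma Rspace_iff: "x \<in> Rspace d \<longleftrightarrow> (\<forall>i. i \<notin> {1..d} \<longrightarrow> coord x i = 0)"
  by (auto simp: Rspace_def in_keys_iff subset_iff simp del: atLeastAtMost_iff)

lemma Rspace_eqI:
  assumes "x \<in> Rspace d" "y \<in> Rspace d" "\<And>i. i \<in> {1..d} \<Longrightarrow> coord x i = coord y i"
  shows "x = y"
  using assms by (intro poly_mapping_eqI) (metis Rspace_iff)

lemma Rspace_0 [simp]: "0 \<in> Rspace d"
  and Rspace_add: "x \<in> Rspace d \<Longrightarrow> y \<in> Rspace d \<Longrightarrow> x + y \<in> Rspace d"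
  and Rspace_scaleR: "x \<in> Rspace d \<Longrightarrow> r *\<^sub>R x \<in> Rspace d"
  and Rspace_uminus: "x \<in> Rspace d \<Longrightarrow> - x \<in> Rspace d"
  by (simp_all add: Rspace_iff lookup_add)

lemma Rspace_unit_vec: "i \<in> {1..d} \<Longrightarrow> unit_vec i \<in> Rspace d"
  by (auto simp: Rspace_iff lookup_single when_def)

lemma Rspace_mono: "d \<le> d' \<Longrightarrow> Rspace d \<subseteq> Rspace d'"
  by (auto simp: Rspace_def)

lemma Rspace_Suc_split:
  assumes "x \<in> Rspace (Suc d)"
  obtains y c where "y \<in> Rspace d" "x = y + c *\<^sub>R unit_vec (Suc d)"
proof
  show "x - coord x (Suc d) *\<^sub>R unit_vec (Suc d) \<in> Rspace d"
    using assms by (auto simp: Rspace_iff lookup_minus lookup_single when_def)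
  show "x = x - coord x (Suc d) *\<^sub>R unit_vec (Suc d) + coord x (Suc d) *\<^sub>R unit_vec (Suc d)"
    by simp
qed

lemma coord_Rspace_Suc: "x \<in> Rspace d \<Longrightarrow> coord x (Suc d) = 0"
  by (simp add: Rspace_iff)

lemma convex_Rspace: "convex (Rspace d)"
  by (intro convexI Rspace_add Rspace_scaleR)

lemma lattice_subset_Rspace: "lattice d \<subseteq> Rspace d"
  by (auto simp: lattice_def)

lemma lattice_mono: "d \<le> d' \<Longrightarrow> lattice d \<subseteq> lattice d'"
  using Rspace_mono by (auto simp: lattice_def)

lemma lattice_0 [simp]: "0 \<in> lattice d"
  and lattice_add: "x \<in> lattice d \<Longrightarrow> y \<in> lattice d \<Longrightarrow> x + y \<in> lattice d"
  and lattice_uminus: "x \<in> lattice d \<Longrightarrow> - x \<in> lattice d"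
  by (simp_all add: lattice_def Rspace_add Rspace_uminus lookup_add)

lemma lattice_sum: "(\<And>i. i \<in> I \<Longrightarrow> f i \<in> lattice d) \<Longrightarrow> sum f I \<in> lattice d"
  by (induction I rule: infinite_finite_induct) (auto simp: lattice_add)

lemma lattice_unit_vec: "i \<in> {1..d} \<Longrightarrow> unit_vec i \<in> lattice d"
  by (simp add: lattice_def Rspace_unit_vec) (simp add: lookup_single when_def)

section \<open>Inner products and polar duals\<close>

lemma inner_prod_add_right: "inner_prod d x (y + z) = inner_prod d x y + inner_prod d x z"
  and inner_prod_add_left: "inner_prod d (x + y) z = inner_prod d x z + inner_prod d y z"
  and inner_prod_scaleR_right: "inner_prod d x (r *\<^sub>R y) = r * inner_prod d x y"
  and inner_prod_scaleR_left: "inner_prod d (r *\<^sub>R x) y = r * inner_prod d x y"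
  and inner_prod_uminus_right: "inner_prod d x (- y) = - inner_prod d x y"
  by (simp_all add: inner_prod_def lookup_add algebra_simps sum.distrib sum_distrib_left sum_negf)

lemma inner_prod_commute: "inner_prod d x y = inner_prod d y x"
  by (simp add: inner_prod_def mult.commute)

lemma inner_prod_sum_right:
  "finite I \<Longrightarrow> inner_prod d x (\<Sum>i\<in>I. f i) = (\<Sum>i\<in>I. inner_prod d x (f i))"
  by (induction I rule: finite_induct) (simp_all add: inner_prod_add_right, simp add: inner_prod_def)

lemma inner_prod_unit_vec: "i \<in> {1..d} \<Longrightarrow> inner_prod d x (unit_vec i) = coord x i"
  by (simp add: inner_prod_def lookup_single when_def if_distrib cong: if_cong)

lemma inner_prod_Suc:
  "inner_prod (Suc d) x y = inner_prod d x y + coord x (Suc d) * coord y (Suc d)"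
  by (simp add: inner_prod_def)

lemma polar_dual_convex_hull: "polar_dual d (convex hull S) = polar_dual d S"
proof (intro equalityI subsetI)
  fix x assume "x \<in> polar_dual d (convex hull S)"
  then show "x \<in> polar_dual d S" by (auto simp: polar_dual_def hull_inc)
next
  fix x assume x: "x \<in> polar_dual d S"
  have "convex {y. -1 \<le> inner_prod d x y}"
  proof (rule convexI)
    fix y z and u v :: real
    assume *: "y \<in> {y. -1 \<le> inner_prod d x y}" "z \<in> {y. -1 \<le> inner_prod d x y}"
      "0 \<le> u" "0 \<le> v" "u + v = 1"
    have "u * (-1) + v * (-1) \<le> u * inner_prod d x y + v * inner_prod d x z"
      using * by (intro add_mono mult_left_mono) auto
    then show "u *\<^sub>R y + v *\<^sub>R z \<in> {y. -1 \<le> inner_prod d x y}"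
      using * by (simp add: inner_prod_add_right inner_prod_scaleR_right)
  qed
  then have "convex hull S \<subseteq> {y. -1 \<le> inner_prod d x y}"
    using x by (intro hull_minimal) (auto simp: polar_dual_def)
  then show "x \<in> polar_dual d (convex hull S)" using x by (auto simp: polar_dual_def)
qed

lemma convex_polar_dual: "convex (polar_dual d Q)"
proof (rule convexI)
  fix x y and u v :: real
  assume *: "x \<in> polar_dual d Q" "y \<in> polar_dual d Q" "0 \<le> u" "0 \<le> v" "u + v = 1"
  have "-1 \<le> inner_prod d (u *\<^sub>R x + v *\<^sub>R y) z" if "z \<in> Q" for z
  proof -
    have "u * (-1) + v * (-1) \<le> u * inner_prod d x z + v * inner_prod d y z"
      using * that by (intro add_mono mult_left_mono) (auto simp: polar_dual_def)
    then show ?thesis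
      using * by (simp add: inner_prod_add_left inner_prod_scaleR_left)
  qed
  then show "u *\<^sub>R x + v *\<^sub>R y \<in> polar_dual d Q"
    using * by (simp add: polar_dual_def Rspace_add Rspace_scaleR)
qed

lemma zero_in_polar_dual: "0 \<in> polar_dual d Q"
  by (simp add: polar_dual_def inner_prod_def)

lemma polar_dual_subset_Rspace: "polar_dual d Q \<subseteq> Rspace d"
  by (auto simp: polar_dual_def)

section \<open>Integral polytopes, segments and the interior\<close>

lemma integral_polytope_convex_hull:
  "finite V \<Longrightarrow> V \<subseteq> lattice d \<Longrightarrow> integral_polytope d (convex hull V)"
  by (auto simp: integral_polytope_def)

text \<open>Convex hulls commute with Minkowski sums, so the sums of generators generate. Prisms and
  zonotopes are handled this way below.\<close>

lemma integral_polytope_plus: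
  assumes "integral_polytope d A" "integral_polytope d B"
  shows "integral_polytope d (A + B)"
proof -
  obtain V W where "finite V" "V \<subseteq> lattice d" "A = convex hull V"
    "finite W" "W \<subseteq> lattice d" "B = convex hull W"
    using assms by (auto simp: integral_polytope_def)
  moreover from this have "V + W \<subseteq> lattice d"
    by (auto simp: set_plus_def intro!: lattice_add)
  ultimately show ?thesis
    by (metis convex_hull_set_plus finite_set_plus integral_polytope_convex_hull)
qed

lemma integral_polytope_mono:
  "integral_polytope d A \<Longrightarrow> d \<le> d' \<Longrightarrow> integral_polytope d' A"
  using lattice_mono[of d d'] by (auto simp: integral_polytope_def)

lemma convex_hull_0_pair: "convex hull {0, w} = {t *\<^sub>R w |t. 0 \<le> t \<and> t \<le> 1}" for w :: "'a::real_vector"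
  unfolding convex_hull_2 by (auto, metis diff_add_cancel diff_ge_0_iff_ge)

lemma convex_hull_uminus_pair: "convex hull {w, - w} = {t *\<^sub>R w |t. \<bar>t\<bar> \<le> 1}" for w :: "'a::real_vector"
proof (intro equalityI subsetI)
  fix x assume "x \<in> convex hull {w, - w}"
  then obtain u v where uv: "0 \<le> u" "0 \<le> v" "u + v = 1" "x = u *\<^sub>R w + v *\<^sub>R (- w)"
    by (auto simp: convex_hull_2)
  then have "x = (u - v) *\<^sub>R w" by (simp add: algebra_simps)
  moreover have "\<bar>u - v\<bar> \<le> 1" using uv by linarith
  ultimately show "x \<in> {t *\<^sub>R w |t. \<bar>t\<bar> \<le> 1}" by blast
next
  fix x assume "x \<in> {t *\<^sub>R w |t. \<bar>t\<bar> \<le> 1}"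
  then obtain t where t: "\<bar>t\<bar> \<le> 1" "x = t *\<^sub>R w" by blast
  \<comment> \<open>The weights solve \<open>u + v = 1\<close> and \<open>u - v = t\<close>.\<close>
  have "x = ((1 + t) / 2) *\<^sub>R w + ((1 - t) / 2) *\<^sub>R (- w)"
    unfolding t by (simp add: scaleR_left_distrib[symmetric] scaleR_left_diff_distrib[symmetric])
      (simp add: field_simps)
  moreover have "0 \<le> (1 + t) / 2" "0 \<le> (1 - t) / 2" "(1 + t) / 2 + (1 - t) / 2 = 1"
    using t by (auto simp: field_simps)
  ultimately show "x \<in> convex hull {w, - w}"
    unfolding convex_hull_2 by blast
qed

text \<open>The metric of the library on finitely supported vectors is the \<open>\<ell>\<^sup>1\<close> metric, so the open unit
  ball meets \<open>R^d\<close> in the interior of the cross-polytope.\<close>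

lemma norm_vec: "x \<in> Rspace d \<Longrightarrow> norm x = (\<Sum>i=1..d. \<bar>coord x i\<bar>)"
proof -
  assume "x \<in> Rspace d"
  then have "Poly_Mapping.keys x \<subseteq> {1..d}" by (simp add: Rspace_def)
  then show ?thesis
    by (auto simp: norm_poly_mapping_def dist_poly_mapping_def in_keys_iff
        intro!: sum.mono_neutral_left)
qed

lemma cross_polytope_subset:
  assumes "convex Q" "0 \<in> Q" "\<And>i. i \<in> {1..d} \<Longrightarrow> unit_vec i \<in> Q \<and> - unit_vec i \<in> Q"
    and "x \<in> Rspace d" "norm x \<le> 1"
  shows "x \<in> Q"
proof -
  \<comment> \<open>Coordinates start at 1, so index 0 is free for the origin, which carries the
    leftover weight \<open>1 - norm x\<close>; the signed unit vectors get the weights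
    \<open>|coord x i|\<close>.\<close>
  define y where "y i = (if i = 0 then 0 else if coord x i < 0 then - unit_vec i else unit_vec i)"
    for i
  define a where "a i = (if i = 0 then 1 - norm x else \<bar>coord x i\<bar>)" for i
  have split: "{0..d} = insert 0 {1..d}" by auto
  have "(\<Sum>i=0..d. a i) = 1"
    using norm_vec[OF assms(4)] unfolding split by (simp add: a_def)
  then have "(\<Sum>i=0..d. a i *\<^sub>R y i) \<in> Q"
    using assms by (intro convex_sum) (auto simp: a_def y_def)
  moreover have "(\<Sum>i=0..d. a i *\<^sub>R y i) = x"
  proof (rule Rspace_eqI[OF _ assms(4)])
    have c: "coord (\<Sum>i=0..d. a i *\<^sub>R y i) j = (if j \<in> {1..d} then coord x j else 0)" for j
    proof -
      have "coord (\<Sum>i=0..d. a i *\<^sub>R y i) j = (\<Sum>i=1..d. coord (a i *\<^sub>R y i) j)"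
        unfolding split by (simp add: lookup_sum lookup_add y_def)
      also have "\<dots> = (\<Sum>i=1..d. if i = j then coord x j else 0)"
        by (intro sum.cong) (auto simp: a_def y_def lookup_single when_def)
      finally show ?thesis by simp
    qed
    show "(\<Sum>i=0..d. a i *\<^sub>R y i) \<in> Rspace d"
      using assms(4) unfolding Rspace_iff c by simp
    show "coord (\<Sum>i=0..d. a i *\<^sub>R y i) i = coord x i" if "i \<in> {1..d}" for i
      using that unfolding c by simp
  qed
  ultimately show ?thesis by simp
qed

lemma zero_in_interior:
  assumes "convex Q" "0 \<in> Q" "\<And>i. i \<in> {1..d} \<Longrightarrow> unit_vec i \<in> Q \<and> - unit_vec i \<in> Q"
  shows "0 \<in> top_of_set (Rspace d) interior_of Q"
  unfolding interior_of_def
proof (intro CollectI exI conjI)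
  show "openin (top_of_set (Rspace d)) (Rspace d \<inter> ball 0 1)"
    by (simp add: openin_open_Int)
  show "Rspace d \<inter> ball 0 1 \<subseteq> Q"
    using cross_polytope_subset[OF assms(1,2), of d] assms(3) by auto
qed auto

subsection \<open>Bipyramids and free sums\<close>

text \<open>The free sum with the segment from -1 to 1 on axis \<open>d + 1\<close>, generated by
  adjoining only the two endpoints.\<close>

definition bipyramid :: "nat \<Rightarrow> vec set \<Rightarrow> vec set" where
  "bipyramid d Q = convex hull (Q \<union> {unit_vec (Suc d), - unit_vec (Suc d)})"

lemma subset_bipyramid: "Q \<subseteq> bipyramid d Q"
  and unit_vec_bipyramid: "unit_vec (Suc d) \<in> bipyramid d Q" "- unit_vec (Suc d) \<in> bipyramid d Q"
  by (auto simp: bipyramid_def hull_inc)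

lemma convex_bipyramid: "convex (bipyramid d Q)"
  by (simp add: bipyramid_def)

lemma bipyramid_subset_Rspace:
  assumes "Q \<subseteq> Rspace d"
  shows "bipyramid d Q \<subseteq> Rspace (Suc d)"
  unfolding bipyramid_def using assms Rspace_mono[of d "Suc d"]
  by (intro hull_minimal convex_Rspace) (auto intro!: Rspace_unit_vec Rspace_uminus)

text \<open>The slice at height \<open>c\<close> is \<open>Q\<close> scaled by
  \<open>1 - |c|\<close>. Since \<open>Q\<close> contains the origin, weight that opposite apexes
  cancel can be moved to the origin.\<close>

lemma mem_bipyramid:
  assumes "convex Q" "0 \<in> Q"
  shows "x \<in> bipyramid d Q \<longleftrightarrow>
    (\<exists>c y. \<bar>c\<bar> \<le> 1 \<and> y \<in> Q \<and> x = (1 - \<bar>c\<bar>) *\<^sub>R y + c *\<^sub>R unit_vec (Suc d))"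
proof
  let ?e = "unit_vec (Suc d) :: vec"
  have "Q \<noteq> {}" "convex hull Q = Q" using assms by (auto simp: hull_same)
  assume "x \<in> bipyramid d Q"
  then have "x \<in> convex hull (insert ?e (insert (- ?e) Q))"
    by (simp add: bipyramid_def)
  then obtain u v b where "0 \<le> u" "0 \<le> v" "u + v = 1"
    "b \<in> convex hull (insert (- ?e) Q)" "x = u *\<^sub>R ?e + v *\<^sub>R b"
    by (subst (asm) convex_hull_insert) auto
  moreover from this(4) obtain u' v' q where "0 \<le> u'" "0 \<le> v'" "u' + v' = 1"
    "q \<in> Q" "b = u' *\<^sub>R (- ?e) + v' *\<^sub>R q"
    using \<open>Q \<noteq> {}\<close> \<open>convex hull Q = Q\<close> by (subst (asm) convex_hull_insert) auto
  ultimately have *: "0 \<le> u" "0 \<le> v" "u + v = 1" "0 \<le> u'" "0 \<le> v'" "u' + v' = 1"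
    "q \<in> Q" "x = u *\<^sub>R ?e + v *\<^sub>R (u' *\<^sub>R (- ?e) + v' *\<^sub>R q)"
    by simp_all
  define c where "c = u - v * u'"
  have "v * u' + v * v' = v" using *(6) by (metis distrib_left mult.right_neutral)
  moreover have "0 \<le> v * u'" "0 \<le> v * v'" using * by simp_all
  \<comment> \<open>The gap between the two sides is \<open>2 * min u (v * u')\<close>, the weight
    lost to cancellation between the apexes.\<close>
  ultimately have le: "v * v' \<le> 1 - \<bar>c\<bar>" and c: "\<bar>c\<bar> \<le> 1"
    using *(1-3) by (simp_all add: c_def)
  have x: "x = (v * v') *\<^sub>R q + c *\<^sub>R ?e"
    unfolding *(8) c_def by (simp add: algebra_simps)
  show "\<exists>c y. \<bar>c\<bar> \<le> 1 \<and> y \<in> Q \<and> x = (1 - \<bar>c\<bar>) *\<^sub>R y + c *\<^sub>R ?e"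
  \<comment> \<open>At an apex the slice is a single point and any \<open>y\<close> in
    \<open>Q\<close> serves; elsewhere \<open>q\<close> is shrunk towards the origin to absorb the
    gap.\<close>
  proof (cases "\<bar>c\<bar> = 1")
    case True
    then have "v * v' = 0" using le \<open>0 \<le> v * v'\<close> by simp
    with True x \<open>q \<in> Q\<close> show ?thesis
      by (intro exI[of _ c] exI[of _ q]) (simp del: mult_eq_0_iff)
  next
    case False
    then have pos: "0 < 1 - \<bar>c\<bar>" using c by simp
    define t where "t = v * v' / (1 - \<bar>c\<bar>)"
    have "0 \<le> t" "t \<le> 1" using pos le \<open>0 \<le> v * v'\<close> by (auto simp: t_def)
    then have "t *\<^sub>R q + (1 - t) *\<^sub>R 0 \<in> Q"
      using assms \<open>q \<in> Q\<close> by (intro convexD) auto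
    moreover have "(v * v') *\<^sub>R q = (1 - \<bar>c\<bar>) *\<^sub>R (t *\<^sub>R q)"
      using pos by (simp add: t_def)
    ultimately show ?thesis using c x by (intro exI[of _ c] exI[of _ "t *\<^sub>R q"]) simp
  qed
next
  let ?e = "unit_vec (Suc d) :: vec"
  assume "\<exists>c y. \<bar>c\<bar> \<le> 1 \<and> y \<in> Q \<and> x = (1 - \<bar>c\<bar>) *\<^sub>R y + c *\<^sub>R ?e"
  then obtain c y where *: "\<bar>c\<bar> \<le> 1" "y \<in> Q" "x = (1 - \<bar>c\<bar>) *\<^sub>R y + c *\<^sub>R ?e" by blast
  define s where "s = (if c < 0 then - ?e else ?e)"
  have "x = (1 - \<bar>c\<bar>) *\<^sub>R y + \<bar>c\<bar> *\<^sub>R s" by (simp add: * s_def)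
  moreover have "y \<in> bipyramid d Q" "s \<in> bipyramid d Q"
    using *(2) subset_bipyramid unit_vec_bipyramid by (auto simp: s_def)
  ultimately show "x \<in> bipyramid d Q"
    using *(1) convexD[OF convex_bipyramid] by simp
qed

section \<open>Lattice points of bipyramids\<close>

lemma mem_scaled_bipyramid:
  assumes "convex Q" "0 \<in> Q"
  shows "x \<in> (\<lambda>x. real k *\<^sub>R x) ` bipyramid d Q \<longleftrightarrow>
    (\<exists>z y. \<bar>z\<bar> \<le> real k \<and> y \<in> Q \<and> x = (real k - \<bar>z\<bar>) *\<^sub>R y + z *\<^sub>R unit_vec (Suc d))"
\<comment> \<open>For positive \<open>k\<close> the heights correspond by \<open>z = k * c\<close>;
  going back divides by \<open>k\<close>, hence the separate case.\<close>
proof (cases "k = 0")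
  case True
  have "bipyramid d Q \<noteq> {}" using unit_vec_bipyramid by blast
  then show ?thesis using True assms(2) by (auto simp: image_constant_conv)
next
  case False
  then have k: "real k > 0" by simp
  have eq: "real k *\<^sub>R ((1 - \<bar>c\<bar>) *\<^sub>R y + c *\<^sub>R e) =
      (real k - \<bar>real k * c\<bar>) *\<^sub>R y + (real k * c) *\<^sub>R e" for c y and e :: vec
    using k by (simp add: abs_mult scaleR_add_right right_diff_distrib)
  show ?thesis
  proof
    assume "x \<in> (\<lambda>x. real k *\<^sub>R x) ` bipyramid d Q"
    then obtain b where b: "b \<in> bipyramid d Q" and xb: "x = real k *\<^sub>R b" by blast
    from b obtain c y where "\<bar>c\<bar> \<le> 1" "y \<in> Q"
      "x = real k *\<^sub>R ((1 - \<bar>c\<bar>) *\<^sub>R y + c *\<^sub>R unit_vec (Suc d))"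
      unfolding xb mem_bipyramid[OF assms] by blast
    then show "\<exists>z y. \<bar>z\<bar> \<le> real k \<and> y \<in> Q \<and> x = (real k - \<bar>z\<bar>) *\<^sub>R y + z *\<^sub>R unit_vec (Suc d)"
      using k unfolding eq
      by (intro exI[of _ "real k * c"] exI[of _ y]) (simp add: abs_mult)
  next
    assume "\<exists>z y. \<bar>z\<bar> \<le> real k \<and> y \<in> Q \<and> x = (real k - \<bar>z\<bar>) *\<^sub>R y + z *\<^sub>R unit_vec (Suc d)"
    then obtain z y where *: "\<bar>z\<bar> \<le> real k" "y \<in> Q"
      "x = (real k - \<bar>z\<bar>) *\<^sub>R y + z *\<^sub>R unit_vec (Suc d)" by blast
    have "x = real k *\<^sub>R ((1 - \<bar>z / real k\<bar>) *\<^sub>R y + (z / real k) *\<^sub>R unit_vec (Suc d))"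
      using k unfolding eq *(3) by simp
    moreover have "\<bar>z / real k\<bar> \<le> 1" using *(1) k by simp
    ultimately show "x \<in> (\<lambda>x. real k *\<^sub>R x) ` bipyramid d Q"
      using *(2) mem_bipyramid[OF assms] by (intro image_eqI) blast+
  qed
qed

lemma add_unit_vec_in_lattice_iff:
  assumes "y \<in> Rspace d"
  shows "y + z *\<^sub>R unit_vec (Suc d) \<in> lattice (Suc d) \<longleftrightarrow> y \<in> lattice d \<and> z \<in> \<int>"
proof
  assume *: "y + z *\<^sub>R unit_vec (Suc d) \<in> lattice (Suc d)"
  then have "coord y i + z * (if i = Suc d then 1 else 0) \<in> \<int>" for i
    by (auto simp: lattice_def lookup_add lookup_single when_def split: if_splits)
  from this[of "Suc d"] this have "z \<in> \<int>" "coord y i \<in> \<int>" for i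
    using assms coord_Rspace_Suc[OF assms] by (auto split: if_splits)
  then show "y \<in> lattice d \<and> z \<in> \<int>" using assms by (simp add: lattice_def)
next
  assume "y \<in> lattice d \<and> z \<in> \<int>"
  then show "y + z *\<^sub>R unit_vec (Suc d) \<in> lattice (Suc d)"
    using Rspace_mono[of d "Suc d"]
    by (auto simp: lattice_def lookup_add lookup_single when_def
        intro!: Rspace_add Rspace_scaleR Rspace_unit_vec)
qed

lemma sum_abs_int_interval:
  fixes h :: "nat \<Rightarrow> 'a::comm_semiring_1"
  shows "(\<Sum>z\<in>{- int k..int k}. h (nat \<bar>z\<bar>)) = h 0 + 2 * (\<Sum>j=1..k. h j)"
proof (induction k)
  case (Suc k)
  have "{- int (Suc k)..int (Suc k)} = insert (int (Suc k)) (insert (- int (Suc k)) {- int k..int k})"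
    by auto
  then show ?case using Suc by (simp add: algebra_simps nat_add_distrib mult_2)
qed simp

abbreviation lattice_points :: "nat \<Rightarrow> vec set \<Rightarrow> nat \<Rightarrow> vec set" where
  "lattice_points d Q k \<equiv> (\<lambda>x. real k *\<^sub>R x) ` Q \<inter> lattice d"

text \<open>Lattice points occur only at integer heights \<open>z\<close>, where the slice is the
  dilate of \<open>Q\<close> by \<open>k - |z|\<close>. The natural subtraction is exact because
  \<open>|z| \<le> k\<close>.\<close>

lemma lattice_points_bipyramid:
  assumes "convex Q" "0 \<in> Q" "Q \<subseteq> Rspace d"
  shows "lattice_points (Suc d) (bipyramid d Q) k =
    (\<Union>z\<in>{- int k..int k}. (\<lambda>y. y + real_of_int z *\<^sub>R unit_vec (Suc d)) `
       lattice_points d Q (k - nat \<bar>z\<bar>))" (is "?L = ?R")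
proof (intro equalityI subsetI)
  fix x assume "x \<in> ?L"
  then obtain z y where *: "\<bar>z\<bar> \<le> real k" "y \<in> Q"
    "x = (real k - \<bar>z\<bar>) *\<^sub>R y + z *\<^sub>R unit_vec (Suc d)" and x: "x \<in> lattice (Suc d)"
    unfolding Int_iff mem_scaled_bipyramid[OF assms(1,2)] by blast
  have "(real k - \<bar>z\<bar>) *\<^sub>R y \<in> Rspace d" using * assms(3) by (auto intro!: Rspace_scaleR)
  then have l: "(real k - \<bar>z\<bar>) *\<^sub>R y \<in> lattice d" and "z \<in> \<int>"
    using x add_unit_vec_in_lattice_iff unfolding * by blast+
  then obtain m where m: "z = real_of_int m" by (auto elim: Ints_cases)
  have mk: "m \<in> {- int k..int k}" using *(1) unfolding m by auto
  then have "real k - \<bar>z\<bar> = real (k - nat \<bar>m\<bar>)" unfolding m by (auto simp: of_nat_diff)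
  then have "(real k - \<bar>z\<bar>) *\<^sub>R y \<in> lattice_points d Q (k - nat \<bar>m\<bar>)"
    using l *(2) by auto
  then show "x \<in> ?R" using mk unfolding *(3) m by blast
next
  fix x assume "x \<in> ?R"
  then obtain m y where m: "m \<in> {- int k..int k}" and y: "y \<in> Q"
    "real (k - nat \<bar>m\<bar>) *\<^sub>R y \<in> lattice d"
    and x: "x = real (k - nat \<bar>m\<bar>) *\<^sub>R y + real_of_int m *\<^sub>R unit_vec (Suc d)" by blast
  have r: "real k - \<bar>real_of_int m\<bar> = real (k - nat \<bar>m\<bar>)" using m by (auto simp: of_nat_diff)
  have "\<bar>real_of_int m\<bar> \<le> real k" using m by auto
  then have "x \<in> (\<lambda>x. real k *\<^sub>R x) ` bipyramid d Q"
    unfolding mem_scaled_bipyramid[OF assms(1,2)] using y(1) x r by metis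
  moreover have "x \<in> lattice (Suc d)"
    using y(2) lattice_subset_Rspace unfolding x by (subst add_unit_vec_in_lattice_iff) auto
  ultimately show "x \<in> ?L" by blast
qed

text \<open>The last coordinate keeps the slices disjoint. The dilate by \<open>k\<close> occurs
  once, at height 0, and each smaller one twice, at opposite heights.\<close>

lemma lattice_count_bipyramid:
  assumes "convex Q" "0 \<in> Q" "Q \<subseteq> Rspace d" and fin: "\<And>k. finite (lattice_points d Q k)"
  shows "finite (lattice_points (Suc d) (bipyramid d Q) k)"
    and "lattice_count (Suc d) (bipyramid d Q) k =
      lattice_count d Q k + 2 * (\<Sum>j<k. lattice_count d Q j)"
proof -
  let ?f = "\<lambda>z y. y + real_of_int z *\<^sub>R unit_vec (Suc d)"
  show "finite (lattice_points (Suc d) (bipyramid d Q) k)"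
    unfolding lattice_points_bipyramid[OF assms(1-3)] using fin by blast
  have "lattice_count (Suc d) (bipyramid d Q) k =
      (\<Sum>z\<in>{- int k..int k}. card (?f z ` lattice_points d Q (k - nat \<bar>z\<bar>)))"
    unfolding lattice_count_def lattice_points_bipyramid[OF assms(1-3)]
  proof (intro card_UN_disjoint ballI impI)
    fix i j :: int assume "i \<noteq> j"
    have "coord (?f z y) (Suc d) = real_of_int z" if "y \<in> lattice d" for z y
      using that lattice_subset_Rspace coord_Rspace_Suc[of y d] by (auto simp: lookup_add)
    then show "?f i ` lattice_points d Q (k - nat \<bar>i\<bar>) \<inter> ?f j ` lattice_points d Q (k - nat \<bar>j\<bar>) = {}"
      using \<open>i \<noteq> j\<close> by auto (metis of_int_eq_iff)
  qed (use fin in auto)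
  also have "\<dots> = (\<Sum>z\<in>{- int k..int k}. lattice_count d Q (k - nat \<bar>z\<bar>))"
    by (intro sum.cong refl) (simp add: lattice_count_def card_image inj_on_def)
  also have "\<dots> = lattice_count d Q k + 2 * (\<Sum>j=1..k. lattice_count d Q (k - j))"
    using sum_abs_int_interval[of "\<lambda>j. lattice_count d Q (k - j)" k] by simp
  also have "(\<Sum>j=1..k. lattice_count d Q (k - j)) = (\<Sum>j<k. lattice_count d Q j)"
    by (rule sum.reindex_bij_witness[of _ "\<lambda>j. k - j" "\<lambda>j. k - j"]) auto
  finally show "lattice_count (Suc d) (bipyramid d Q) k =
      lattice_count d Q k + 2 * (\<Sum>j<k. lattice_count d Q j)" .
qed

text \<open>Duality turns a free sum into a product: \<open>Q\<close> constrains the first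
  \<open>d\<close> coordinates and the apexes bound the last one. The resulting prism is written as
  a Minkowski sum so that integrality carries over.\<close>

lemma polar_dual_bipyramid:
  assumes "Q \<subseteq> Rspace d"
  shows "polar_dual (Suc d) (bipyramid d Q) =
    polar_dual d Q + convex hull {unit_vec (Suc d), - unit_vec (Suc d)}"
proof -
  let ?e = "unit_vec (Suc d) :: vec"
  have *: "y + c *\<^sub>R ?e \<in> polar_dual (Suc d) (Q \<union> {?e, - ?e}) \<longleftrightarrow> y \<in> polar_dual d Q \<and> \<bar>c\<bar> \<le> 1"
    if y: "y \<in> Rspace d" for y c
  proof -
    have "inner_prod (Suc d) (y + c *\<^sub>R ?e) v = inner_prod d y v" if "v \<in> Q" for v
    proof -
      have v: "v \<in> Rspace d" using that assms by blast
      have "inner_prod d ?e v = 0" by (simp add: inner_prod_def lookup_single when_def)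
      then show ?thesis
        by (simp add: inner_prod_Suc inner_prod_add_left inner_prod_scaleR_left
            coord_Rspace_Suc[OF v])
    qed
    moreover have "inner_prod (Suc d) (y + c *\<^sub>R ?e) ?e = c"
      using coord_Rspace_Suc[OF y] by (simp add: inner_prod_unit_vec lookup_add)
    moreover have "y + c *\<^sub>R ?e \<in> Rspace (Suc d)"
      using y Rspace_mono[of d "Suc d"] by (auto intro!: Rspace_add Rspace_scaleR Rspace_unit_vec)
    ultimately show ?thesis
      using y by (auto simp: polar_dual_def inner_prod_uminus_right)
  qed
  show ?thesis
    unfolding bipyramid_def polar_dual_convex_hull convex_hull_uminus_pair
  proof (intro equalityI subsetI)
    fix x assume x: "x \<in> polar_dual (Suc d) (Q \<union> {?e, - ?e})"
    then have "x \<in> Rspace (Suc d)" using polar_dual_subset_Rspace by blast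
    then obtain y c where "y \<in> Rspace d" "x = y + c *\<^sub>R ?e" by (rule Rspace_Suc_split)
    with x * show "x \<in> polar_dual d Q + {t *\<^sub>R ?e |t. \<bar>t\<bar> \<le> 1}" by (auto simp: set_plus_def)
  next
    fix x assume "x \<in> polar_dual d Q + {t *\<^sub>R ?e |t. \<bar>t\<bar> \<le> 1}"
    then show "x \<in> polar_dual (Suc d) (Q \<union> {?e, - ?e})"
      using * polar_dual_subset_Rspace by (force simp: set_plus_def)
  qed
qed

lemma integral_polytope_bipyramid:
  assumes "integral_polytope d Q"
  shows "integral_polytope (Suc d) (bipyramid d Q)"
proof -
  obtain V where V: "finite V" "V \<subseteq> lattice d" "Q = convex hull V"
    using assms by (auto simp: integral_polytope_def)
  then have "bipyramid d Q = convex hull (V \<union> {unit_vec (Suc d), - unit_vec (Suc d)})"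
    unfolding bipyramid_def by (simp only: hull_Un_left[symmetric])
  then show ?thesis
    using V lattice_mono[of d "Suc d"]
    by (auto intro!: integral_polytope_convex_hull lattice_unit_vec lattice_uminus)
qed

lemma integral_polytope_polar_dual_bipyramid:
  assumes "integral_polytope d (polar_dual d Q)" "Q \<subseteq> Rspace d"
  shows "integral_polytope (Suc d) (polar_dual (Suc d) (bipyramid d Q))"
  unfolding polar_dual_bipyramid[OF assms(2)]
  by (intro integral_polytope_plus integral_polytope_mono[OF assms(1)] integral_polytope_convex_hull)
    (auto intro!: lattice_unit_vec lattice_uminus)

section \<open>Coordinate shifts and iterated free sums with a segment\<close>

lemma coord_shift: "coord (shift d x) j = (if d \<le> j then coord x (j - d) else 0)"
proof -
  have "coord (shift d x) j = (\<Sum>i\<in>Poly_Mapping.keys x. if i = j - d \<and> d \<le> j then coord x i else 0)"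
    by (auto simp: shift_def lookup_sum lookup_single when_def intro!: sum.cong)
  also have "\<dots> = (if d \<le> j then coord x (j - d) else 0)"
    by (auto simp: in_keys_iff)
  finally show ?thesis .
qed

lemma linear_shift: "linear (shift d)"
  by (intro linearI poly_mapping_eqI) (simp_all add: coord_shift lookup_add)

lemma shift_shift: "shift a (shift b x) = shift (a + b) x"
  by (intro poly_mapping_eqI) (auto simp: coord_shift)

lemma shift_unit_vec: "shift d (unit_vec i) = unit_vec (d + i)"
  by (intro poly_mapping_eqI) (auto simp: coord_shift lookup_single when_def)

lemma shift_segment:
  "shift d ` (convex hull {unit_vec 1, - unit_vec 1}) =
   convex hull {unit_vec (Suc d), - unit_vec (Suc d)}"
  by (simp add: convex_hull_linear_image[OF linear_shift] shift_unit_vec linear_neg[OF linear_shift])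

text \<open>Nested hulls of unions are associative, so the last segment can be split off the whole
  free sum. There it lies on axis \<open>d + n + 1\<close>.\<close>

lemma free_sum_power_segment_Suc:
  fixes d n :: nat
  defines "I \<equiv> convex hull {unit_vec 1, - unit_vec 1 :: vec}"
  shows "free_sum d Q (free_sum_power 1 I (Suc n)) =
    bipyramid (d + n) (free_sum d Q (free_sum_power 1 I n))"
proof -
  have "free_sum d Q (free_sum_power 1 I (Suc n)) =
      convex hull (Q \<union> convex hull (shift d ` free_sum_power 1 I n \<union> shift (d + n) ` I))"
    by (simp add: free_sum_def convex_hull_linear_image[OF linear_shift] image_Un image_image
        shift_shift)
  also have "\<dots> = convex hull (convex hull (Q \<union> shift d ` free_sum_power 1 I n) \<union> shift (d + n) ` I)"
    by (simp add: Un_assoc flip: hull_Un_left hull_Un_right)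
  also have "\<dots> = bipyramid (d + n) (free_sum d Q (free_sum_power 1 I n))"
    by (simp add: free_sum_def bipyramid_def I_def shift_segment[unfolded One_nat_def]
        flip: hull_Un_right)
  finally show ?thesis .
qed

lemma free_sum_zero:
  assumes "convex Q" "0 \<in> Q"
  shows "free_sum d Q {0} = Q"
  using assms by (simp add: free_sum_def linear_0[OF linear_shift] insert_absorb hull_same)

subsection \<open>The root polytope and its dual\<close>

text \<open>Coordinates adapted to \<open>A_polytope\<close>: its generators pair with
  \<open>x\<close> to signed differences of these sums.\<close>

definition partial_sum :: "vec \<Rightarrow> nat \<Rightarrow> real" where
  "partial_sum x i = (\<Sum>k=1..i. coord x k)"

text \<open>The linear map from \<open>R^(d+1)\<close>, with indices \<open>0..d\<close>, to
  \<open>R^d\<close> whose kernel is the constants; \<open>partial_sum\<close> inverts it up to an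
  additive constant.\<close>

definition diff_vec :: "nat \<Rightarrow> (nat \<Rightarrow> real) \<Rightarrow> vec" where
  "diff_vec d t = (\<Sum>i=1..d. Poly_Mapping.single i (t i - t (i - 1)))"

lemma coord_diff_vec: "coord (diff_vec d t) i = (if i \<in> {1..d} then t i - t (i - 1) else 0)"
  by (simp add: diff_vec_def lookup_sum lookup_single when_def)

lemma diff_vec_in_Rspace: "diff_vec d t \<in> Rspace d"
  by (simp add: Rspace_iff coord_diff_vec)

lemma partial_sum_diff_vec: "i \<le> d \<Longrightarrow> partial_sum (diff_vec d t) i = t i - t 0"
  by (induction i) (simp_all add: partial_sum_def coord_diff_vec)

lemma diff_vec_partial_sum:
  assumes "x \<in> Rspace d"
  shows "diff_vec d (\<lambda>i. partial_sum x i - c) = x"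
proof (rule Rspace_eqI[OF diff_vec_in_Rspace assms])
  fix i assume i: "i \<in> {1..d}"
  then obtain j where "i = Suc j" by (cases i) auto
  then show "coord (diff_vec d (\<lambda>i. partial_sum x i - c)) i = coord x i"
    using i by (simp add: coord_diff_vec partial_sum_def)
qed

lemma diff_vec_cong: "(\<And>i. i \<le> d \<Longrightarrow> s i = t i) \<Longrightarrow> diff_vec d s = diff_vec d t"
  unfolding diff_vec_def by (intro sum.cong) auto

lemma scaleR_diff_vec: "r *\<^sub>R diff_vec d t = diff_vec d (\<lambda>i. r * t i)"
  by (intro poly_mapping_eqI) (simp add: coord_diff_vec right_diff_distrib)

text \<open>Expansion along the images of the \<open>d + 1\<close> unit vectors, which generate the
  zonotope below.\<close>

lemma diff_vec_eq_sum:
  "diff_vec d t = (\<Sum>i\<le>d. t i *\<^sub>R diff_vec d (\<lambda>j. if j = i then 1 else 0))"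
proof (intro poly_mapping_eqI)
  fix k
  show "coord (diff_vec d t) k =
      coord (\<Sum>i\<le>d. t i *\<^sub>R diff_vec d (\<lambda>j. if j = i then 1 else 0)) k"
  proof (cases "k \<in> {1..d}")
    case True
    then have "coord (\<Sum>i\<le>d. t i *\<^sub>R diff_vec d (\<lambda>j. if j = i then 1 else 0)) k =
        (\<Sum>i\<le>d. (if i = k then t i else 0) - (if i = k - 1 then t i else 0))"
      unfolding lookup_sum by (intro sum.cong) (auto simp: coord_diff_vec)
    also have "\<dots> = t k - t (k - 1)"
      using True by (simp add: sum_subtractf) linarith
    finally show ?thesis using True by (simp add: coord_diff_vec)
  qed (auto simp: lookup_sum coord_diff_vec)
qed

lemma diff_vec_in_lattice: "(\<And>i. i \<le> d \<Longrightarrow> t i \<in> \<int>) \<Longrightarrow> diff_vec d t \<in> lattice d"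
  by (auto simp: lattice_def diff_vec_in_Rspace coord_diff_vec)

text \<open>Summation by parts; both boundary terms vanish because coordinates \<open>0\<close> and \<open>d + 1\<close> are zero.\<close>

lemma inner_prod_diff_vec:
  assumes "x \<in> Rspace d"
  shows "inner_prod d x (diff_vec d t) = (\<Sum>i\<le>d. t i * (coord x i - coord x (Suc i)))"
proof -
  have 0: "coord x 0 = 0" "coord x (Suc d) = 0" using assms by (auto simp: Rspace_iff)
  have "inner_prod d x (diff_vec d t) =
      (\<Sum>k=1..d. t k * coord x k) - (\<Sum>k=1..d. t (k - 1) * coord x k)"
    by (simp add: inner_prod_def coord_diff_vec algebra_simps flip: sum_subtractf)
  also have "(\<Sum>k=1..d. t k * coord x k) = (\<Sum>i\<le>d. t i * coord x i)"
    using 0 by (intro sum.mono_neutral_left) (auto simp: not_le)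
  also have "(\<Sum>k=1..d. t (k - 1) * coord x k) = (\<Sum>i<d. t i * coord x (Suc i))"
    by (rule sum.reindex_bij_witness[of _ Suc "\<lambda>k. k - 1"]) auto
  also have "\<dots> = (\<Sum>i\<le>d. t i * coord x (Suc i))"
    using 0 by (simp flip: lessThan_Suc_atMost)
  finally show ?thesis by (simp add: right_diff_distrib sum_subtractf)
qed

lemma inner_prod_sum_unit_vec:
  assumes "1 \<le> i" "i \<le> j" "j \<le> d"
  shows "inner_prod d x (\<Sum>k=i..j. unit_vec k) = partial_sum x j - partial_sum x (i - 1)"
proof -
  have "{1..j} = {1..i - 1} \<union> {i..j}" "{1..i - 1} \<inter> {i..j} = {}" using assms by auto
  then have "partial_sum x j = partial_sum x (i - 1) + (\<Sum>k=i..j. coord x k)"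
    unfolding partial_sum_def by (simp add: sum.union_disjoint)
  moreover have "inner_prod d x (\<Sum>k=i..j. unit_vec k) = (\<Sum>k=i..j. coord x k)"
    unfolding inner_prod_sum_right[OF finite_atLeastAtMost]
    using assms by (intro sum.cong) (auto simp: inner_prod_unit_vec)
  ultimately show ?thesis by simp
qed

text \<open>An interval starting at \<open>i\<close> pairs to a difference with lower index
  \<open>i - 1\<close>, so the indices run over \<open>0..d\<close>. Both signs of each generator
  make the condition symmetric in the two indices.\<close>

lemma mem_polar_dual_A_polytope:
  "x \<in> polar_dual d (A_polytope d) \<longleftrightarrow>
    x \<in> Rspace d \<and> (\<forall>i\<le>d. \<forall>j\<le>d. partial_sum x j - partial_sum x i \<le> 1)"
proof -
  have "x \<in> polar_dual d (A_polytope d) \<longleftrightarrow> x \<in> Rspace d \<and>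
      (\<forall>i j. 1 \<le> i \<and> i \<le> j \<and> j \<le> d \<longrightarrow> \<bar>partial_sum x j - partial_sum x (i - 1)\<bar> \<le> 1)"
    unfolding A_polytope_def polar_dual_convex_hull
    by (fastforce simp: polar_dual_def inner_prod_uminus_right inner_prod_sum_unit_vec abs_le_iff)
  also have "(\<forall>i j. 1 \<le> i \<and> i \<le> j \<and> j \<le> d \<longrightarrow> \<bar>partial_sum x j - partial_sum x (i - 1)\<bar> \<le> 1) \<longleftrightarrow>
      (\<forall>i\<le>d. \<forall>j\<le>d. partial_sum x j - partial_sum x i \<le> 1)" (is "?L \<longleftrightarrow> ?R")
  proof
    assume L: ?L
    have *: "\<bar>partial_sum x j - partial_sum x i\<bar> \<le> 1" if "i < j" "j \<le> d" for i j
      using L[rule_format, of "Suc i" j] that by simp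
    show ?R
    proof (intro allI impI)
      fix i j assume "i \<le> d" "j \<le> d"
      then show "partial_sum x j - partial_sum x i \<le> 1"
        using *[of i j] *[of j i] by (cases i j rule: linorder_cases) auto
    qed
  next
    assume R: ?R
    show ?L
    proof (intro allI impI)
      fix i j assume ij: "1 \<le> i \<and> i \<le> j \<and> j \<le> d"
      then have "i - 1 \<le> d" by linarith
      with ij show "\<bar>partial_sum x j - partial_sum x (i - 1)\<bar> \<le> 1"
        using R[rule_format, of "i - 1" j] R[rule_format, of j "i - 1"] by (simp add: abs_le_iff)
    qed
  qed
  finally show ?thesis .
qed

text \<open>Partial sums of spread at most 1 fall into the unit interval once their minimum is
  subtracted, which leaves \<open>diff_vec\<close> unchanged.\<close>

lemma polar_dual_A_polytope_eq:
  "polar_dual d (A_polytope d) = {diff_vec d t |t. \<forall>i\<le>d. 0 \<le> t i \<and> t i \<le> 1}"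
proof (intro equalityI subsetI)
  fix x assume x: "x \<in> polar_dual d (A_polytope d)"
  define m where "m = Min (partial_sum x ` {..d})"
  have "m \<in> partial_sum x ` {..d}" unfolding m_def by (intro Min_in) auto
  then obtain j where j: "j \<le> d" "m = partial_sum x j" by auto
  have "0 \<le> partial_sum x i - m \<and> partial_sum x i - m \<le> 1" if "i \<le> d" for i
  proof
    show "0 \<le> partial_sum x i - m" using that unfolding m_def by (simp add: Min_le)
    show "partial_sum x i - m \<le> 1" using that x j by (simp add: mem_polar_dual_A_polytope)
  qed
  moreover have "x = diff_vec d (\<lambda>i. partial_sum x i - m)"
    using x by (simp add: diff_vec_partial_sum mem_polar_dual_A_polytope)
  ultimately show "x \<in> {diff_vec d t |t. \<forall>i\<le>d. 0 \<le> t i \<and> t i \<le> 1}" by blast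
next
  fix x assume "x \<in> {diff_vec d t |t. \<forall>i\<le>d. 0 \<le> t i \<and> t i \<le> 1}"
  then obtain t where t: "\<forall>i\<le>d. 0 \<le> t i \<and> t i \<le> 1" "x = diff_vec d t" by blast
  have "t j - t i \<le> 1" if "i \<le> d" "j \<le> d" for i j
    using t(1)[rule_format, OF that(1)] t(1)[rule_format, OF that(2)] by simp
  then show "x \<in> polar_dual d (A_polytope d)"
    by (simp add: t mem_polar_dual_A_polytope diff_vec_in_Rspace partial_sum_diff_vec)
qed

lemma diff_vec_in_polar_dual_A_polytope:
  "(\<And>i. i \<le> d \<Longrightarrow> 0 \<le> t i \<and> t i \<le> 1) \<Longrightarrow> diff_vec d t \<in> polar_dual d (A_polytope d)"
  by (auto simp: polar_dual_A_polytope_eq)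

lemma integral_polytope_zero: "integral_polytope d {0}"
  using integral_polytope_convex_hull[of "{0}" d] by simp

lemma integral_polytope_sum:
  "(\<And>i. i \<in> I \<Longrightarrow> integral_polytope d (A i)) \<Longrightarrow> integral_polytope d (sum A I)"
  by (induction I rule: infinite_finite_induct)
    (auto simp: integral_polytope_plus integral_polytope_zero set_zero)

text \<open>The dual of \<open>A_d\<close> is a zonotope, the image of the cube \<open>[0,1]^(d+1)\<close> under \<open>diff_vec d\<close>.\<close>

lemma integral_polytope_polar_dual_A_polytope: "integral_polytope d (polar_dual d (A_polytope d))"
proof -
  let ?w = "\<lambda>i. diff_vec d (\<lambda>j. if j = i then 1 else 0)"
  have "polar_dual d (A_polytope d) = (\<Sum>i\<le>d. convex hull {0, ?w i})"
  proof (intro equalityI subsetI)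
    fix x assume "x \<in> polar_dual d (A_polytope d)"
    then obtain t where t: "\<forall>i\<le>d. 0 \<le> t i \<and> t i \<le> 1" "x = diff_vec d t"
      unfolding polar_dual_A_polytope_eq by blast
    then have "x = (\<Sum>i\<le>d. t i *\<^sub>R ?w i)" by (simp only: diff_vec_eq_sum[of d t])
    moreover have "\<forall>i\<in>{..d}. t i *\<^sub>R ?w i \<in> convex hull {0, ?w i}"
      using t(1) unfolding convex_hull_0_pair by blast
    ultimately show "x \<in> (\<Sum>i\<le>d. convex hull {0, ?w i})"
      unfolding set_sum_alt[OF finite_atMost] by (intro CollectI exI conjI)
  next
    fix x assume "x \<in> (\<Sum>i\<le>d. convex hull {0, ?w i})"
    then obtain s where s: "x = sum s {..d}" "\<forall>i\<le>d. \<exists>t. s i = t *\<^sub>R ?w i \<and> 0 \<le> t \<and> t \<le> 1"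
      unfolding set_sum_alt[OF finite_atMost] convex_hull_0_pair by auto
    from s(2) obtain t where t: "\<forall>i\<le>d. s i = t i *\<^sub>R ?w i \<and> 0 \<le> t i \<and> t i \<le> 1" by metis
    have "x = (\<Sum>i\<le>d. t i *\<^sub>R ?w i)" unfolding s(1) using t by (intro sum.cong) auto
    then have "x = diff_vec d t" by (simp only: diff_vec_eq_sum[of d t])
    then show "x \<in> polar_dual d (A_polytope d)"
      using t by (simp add: diff_vec_in_polar_dual_A_polytope)
  qed
  moreover have "?w i \<in> lattice d" for i by (rule diff_vec_in_lattice) simp
  ultimately show ?thesis
    by (auto intro!: integral_polytope_sum integral_polytope_convex_hull)
qed

lemma unit_vec_polar_dual_A_polytope:
  assumes "i \<in> {1..d}"
  shows "unit_vec i \<in> polar_dual d (A_polytope d) \<and> - unit_vec i \<in> polar_dual d (A_polytope d)"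
proof -
  \<comment> \<open>Step functions that jump up or down at \<open>i\<close>.\<close>
  have "unit_vec i = diff_vec d (\<lambda>j. if i \<le> j then 1 else 0)"
    "- unit_vec i = diff_vec d (\<lambda>j. if i \<le> j then 0 else 1)"
    using assms by (auto intro!: poly_mapping_eqI simp: coord_diff_vec lookup_single when_def)
  then show ?thesis by (simp add: diff_vec_in_polar_dual_A_polytope)
qed

lemma polar_dual_A_polytope_1:
  "polar_dual 1 (A_polytope 1) = convex hull {unit_vec 1, - unit_vec 1}"
proof -
  have all: "(\<forall>i\<le>1. P i) \<longleftrightarrow> P 0 \<and> P 1" for P :: "nat \<Rightarrow> bool"
    by (auto simp: le_Suc_eq)
  have mem: "x \<in> polar_dual 1 (A_polytope 1) \<longleftrightarrow> x \<in> Rspace 1 \<and> \<bar>coord x 1\<bar> \<le> 1" for x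
    unfolding mem_polar_dual_A_polytope all by (auto simp: partial_sum_def)
  show ?thesis
    unfolding convex_hull_uminus_pair
  proof (intro equalityI subsetI)
    fix x assume x: "x \<in> polar_dual 1 (A_polytope 1)"
    then have "x = coord x 1 *\<^sub>R unit_vec 1"
      unfolding mem by (intro Rspace_eqI[of _ 1]) (auto intro!: Rspace_scaleR Rspace_unit_vec)
    then show "x \<in> {t *\<^sub>R unit_vec 1 |t. \<bar>t\<bar> \<le> 1}" using x unfolding mem by blast
  next
    fix x assume "x \<in> {t *\<^sub>R unit_vec 1 :: vec |t. \<bar>t\<bar> \<le> 1}"
    then show "x \<in> polar_dual 1 (A_polytope 1)"
      unfolding mem by (auto intro!: Rspace_scaleR Rspace_unit_vec)
  qed
qed

section \<open>Biduality of the root polytope\<close>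

lemma A_polytope_generator:
  assumes "1 \<le> i" "i \<le> j" "j \<le> d"
  shows "(\<Sum>k=i..j. unit_vec k) \<in> A_polytope d" "- (\<Sum>k=i..j. unit_vec k) \<in> A_polytope d"
  using assms unfolding A_polytope_def by (auto intro!: hull_inc)

lemma convex_A_polytope: "convex (A_polytope d)"
  by (simp add: A_polytope_def)

lemma zero_in_A_polytope:
  assumes "1 \<le> d"
  shows "0 \<in> A_polytope d"
proof -
  have "(1/2) *\<^sub>R (\<Sum>k=1..1. unit_vec k) + (1/2) *\<^sub>R (- (\<Sum>k=1..1. unit_vec k)) \<in> A_polytope d"
    using assms by (intro convexD[OF convex_A_polytope] A_polytope_generator) auto
  then show ?thesis by simp
qed

lemma integral_polytope_A_polytope: "integral_polytope d (A_polytope d)"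
  unfolding A_polytope_def
proof (rule integral_polytope_convex_hull)
  have "{(i, j). 1 \<le> i \<and> i \<le> j \<and> j \<le> d} \<subseteq> {..d} \<times> {..d}" by auto
  then have "finite {(i, j). 1 \<le> i \<and> i \<le> j \<and> j \<le> d}" by (rule finite_subset) simp
  then show "finite (\<Union>(i, j) \<in> {(i, j). 1 \<le> i \<and> i \<le> j \<and> j \<le> d}.
        {(\<Sum>k=i..j. unit_vec k), - (\<Sum>k=i..j. unit_vec k :: vec)})"
    by (rule finite_UN_I) auto
qed (auto intro!: lattice_sum lattice_unit_vec lattice_uminus)

lemma A_polytope_subset_Rspace: "A_polytope d \<subseteq> Rspace d"
  unfolding A_polytope_def using lattice_subset_Rspace
  by (intro hull_minimal convex_Rspace)
    (auto intro!: subsetD[OF lattice_subset_Rspace] lattice_sum lattice_unit_vec lattice_uminus)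

text \<open>Write \<open>x = \<Sum>\<^sub>i u\<^sub>i y\<^sub>i\<close> with \<open>\<Sum>\<^sub>i u\<^sub>i = 0\<close> and all \<open>y\<^sub>i - y\<^sub>j\<close> in \<open>A_d\<close>; shipping the positive part of
  \<open>u\<close> to the negative part, of equal mass \<open>p\<close>, expresses \<open>x\<close> by these differences with total weight
  \<open>p\<close>. The vertex of the dual that selects the indices with \<open>u\<^sub>i \<le> 0\<close> witnesses \<open>p \<le> 1\<close>.\<close>

lemma polar_dual_polar_dual_A_polytope:
  assumes "1 \<le> d"
  shows "polar_dual d (polar_dual d (A_polytope d)) = A_polytope d"
proof (intro equalityI subsetI)
  fix x assume "x \<in> A_polytope d"
  then show "x \<in> polar_dual d (polar_dual d (A_polytope d))"
    using A_polytope_subset_Rspace by (auto simp: polar_dual_def inner_prod_commute[of d x])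
next
  fix x assume x: "x \<in> polar_dual d (polar_dual d (A_polytope d))"
  then have xR: "x \<in> Rspace d" by (simp add: polar_dual_def)
  \<comment> \<open>These are the coefficients of \<open>t\<close> in the pairing of
    \<open>x\<close> with \<open>diff_vec d t\<close>.\<close>
  define u where "u i = coord x i - coord x (Suc i)" for i
  define a where "a i = max 0 (u i)" for i
  define b where "b i = max 0 (- u i)" for i
  \<comment> \<open>Negated tail sums: the difference of two tails is a signed interval sum.\<close>
  define y :: "nat \<Rightarrow> vec" where "y i = - (\<Sum>k=Suc i..d. unit_vec k)" for i
  define p where "p = (\<Sum>i\<le>d. b i)"
  have 0: "coord x 0 = 0" "coord x (Suc d) = 0" using xR by (auto simp: Rspace_iff)
  have telescope: "(\<Sum>i<k. u i) = - coord x k" for k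
    using 0 by (induction k) (simp_all add: u_def)
  have u_ab: "u i = a i - b i" for i by (simp add: a_def b_def)
  have "(\<Sum>i\<le>d. u i) = 0" using telescope[of "Suc d"] 0 by (simp add: lessThan_Suc_atMost)
  then have sum_a: "(\<Sum>i\<le>d. a i) = p" by (simp add: u_ab sum_subtractf p_def)
  have "(\<Sum>i\<le>d. a i) \<ge> 0" by (intro sum_nonneg) (simp add: a_def)
  then have "0 \<le> p" using sum_a by simp
  have "p \<le> 1"
  proof -
    define t where "t i = (if u i \<le> 0 then 1 else 0 :: real)" for i
    have "diff_vec d t \<in> polar_dual d (A_polytope d)"
      by (rule diff_vec_in_polar_dual_A_polytope) (simp add: t_def)
    then have "-1 \<le> inner_prod d x (diff_vec d t)" using x by (simp add: polar_dual_def)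
    also have "\<dots> = (\<Sum>i\<le>d. - b i)"
      unfolding inner_prod_diff_vec[OF xR] by (intro sum.cong) (auto simp: t_def b_def u_def)
    finally show ?thesis by (simp add: p_def sum_negf)
  qed
  have x_eq: "x = (\<Sum>i\<le>d. u i *\<^sub>R y i)"
  proof (intro poly_mapping_eqI)
    fix k
    have "coord (y i) k = (if i < k \<and> k \<le> d then -1 else 0)" for i
      by (auto simp: y_def lookup_sum lookup_single when_def)
    then have "coord (\<Sum>i\<le>d. u i *\<^sub>R y i) k = (\<Sum>i\<le>d. if i < k \<and> k \<le> d then - u i else 0)"
      by (auto simp: lookup_sum intro!: sum.cong)
    also have "\<dots> = (if k \<le> d then \<Sum>i<k. - u i else 0)"
      by (auto intro!: sum.mono_neutral_cong_right split: if_splits)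
    also have "\<dots> = coord x k"
      using xR by (auto simp: sum_negf telescope Rspace_iff)
    finally show "coord x k = coord (\<Sum>i\<le>d. u i *\<^sub>R y i) k" ..
  qed
  have diff: "y i - y j \<in> A_polytope d" if "i \<le> d" "j \<le> d" for i j
  proof -
    have "y i - y j = - (\<Sum>k=Suc i..j. unit_vec k)" if "i < j" "j \<le> d" for i j
    proof -
      have "{Suc i..d} = {Suc i..j} \<union> {Suc j..d}" using that by auto
      then have "(\<Sum>k=Suc i..d. unit_vec k :: vec) =
          (\<Sum>k=Suc i..j. unit_vec k) + (\<Sum>k=Suc j..d. unit_vec k)"
        by (simp add: sum.union_disjoint)
      then show ?thesis by (simp add: y_def)
    qed
    note this[of i j] this[of j i]
    moreover have "y i - y j = - (y j - y i)" by simp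
    ultimately show ?thesis
      using that zero_in_A_polytope[OF assms] A_polytope_generator[of "Suc i" j d]
        A_polytope_generator[of "Suc j" i d]
      by (cases i j rule: linorder_cases) (simp_all del: minus_diff_eq)
  qed
  show "x \<in> A_polytope d"
  proof (cases "p = 0")
    case True
    have "\<forall>i\<in>{..d}. a i = 0" "\<forall>i\<in>{..d}. b i = 0"
      using True sum_a by (subst sum_nonneg_eq_0_iff[symmetric]; simp add: p_def a_def b_def)+
    then have "x = 0" unfolding x_eq u_ab by simp
    then show ?thesis using zero_in_A_polytope[OF assms] by simp
  next
    case False
    then have "0 < p" using \<open>0 \<le> p\<close> by simp
    \<comment> \<open>The product of the normalised weights is a transport plan with marginals
      \<open>a / p\<close> and \<open>b / p\<close>, so \<open>q\<close> collapses to
      \<open>x / p\<close>.\<close>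
    define q where "q = (\<Sum>(i, j)\<in>{..d} \<times> {..d}. ((a i / p) * (b j / p)) *\<^sub>R (y i - y j))"
    have sum1: "(\<Sum>i\<le>d. a i / p) = 1" "(\<Sum>i\<le>d. b i / p) = 1"
      using sum_a \<open>0 < p\<close> by (simp_all add: p_def flip: sum_divide_distrib)
    have "q \<in> A_polytope d"
      unfolding q_def split_def
    proof (rule convex_sum[OF _ convex_A_polytope])
      show "(\<Sum>k\<in>{..d} \<times> {..d}. a (fst k) / p * (b (snd k) / p)) = 1"
        using sum_product[of "\<lambda>i. a i / p" "{..d}" "\<lambda>j. b j / p" "{..d}"]
        by (simp only: sum1 sum.cartesian_product split_def mult_1)
    qed (use \<open>0 < p\<close> diff in \<open>auto simp: a_def b_def\<close>)
    \<comment> \<open>Since \<open>p \<le> 1\<close>, scaling back by \<open>p\<close> is a convex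
      combination with the origin.\<close>
    then have "p *\<^sub>R q + (1 - p) *\<^sub>R 0 \<in> A_polytope d"
      using \<open>0 \<le> p\<close> \<open>p \<le> 1\<close> zero_in_A_polytope[OF assms] by (intro convexD[OF convex_A_polytope]) auto
    moreover have "p *\<^sub>R q = x"
    proof -
      have "q = (\<Sum>i\<le>d. \<Sum>j\<le>d. ((a i / p) * (b j / p)) *\<^sub>R y i) -
          (\<Sum>i\<le>d. \<Sum>j\<le>d. ((a i / p) * (b j / p)) *\<^sub>R y j)"
        unfolding q_def by (simp add: sum.cartesian_product scaleR_right_diff_distrib sum_subtractf split_def)
      also have "(\<Sum>i\<le>d. \<Sum>j\<le>d. ((a i / p) * (b j / p)) *\<^sub>R y i) =
          (\<Sum>i\<le>d. ((a i / p) * (\<Sum>j\<le>d. b j / p)) *\<^sub>R y i)"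
        by (simp add: sum_distrib_left scaleR_sum_left)
      also have "(\<Sum>i\<le>d. \<Sum>j\<le>d. ((a i / p) * (b j / p)) *\<^sub>R y j) =
          (\<Sum>j\<le>d. ((\<Sum>i\<le>d. a i / p) * (b j / p)) *\<^sub>R y j)"
        by (subst sum.swap) (simp only: sum_distrib_right scaleR_sum_left)
      finally have "q = (\<Sum>i\<le>d. (a i / p) *\<^sub>R y i) - (\<Sum>i\<le>d. (b i / p) *\<^sub>R y i)"
        unfolding sum1 by simp
      then show ?thesis
        using \<open>0 < p\<close> by (simp add: x_eq u_ab scaleR_right_diff_distrib
          scaleR_left_diff_distrib scaleR_sum_right sum_subtractf)
    qed
    ultimately show ?thesis by simp
  qed
qed

section \<open>Lattice points in dilates of the dual\<close>

lemma mem_scaled_polar_dual_A_polytope: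
  "x \<in> (\<lambda>x. real k *\<^sub>R x) ` polar_dual d (A_polytope d) \<longleftrightarrow>
    (\<exists>t. (\<forall>i\<le>d. 0 \<le> t i \<and> t i \<le> real k) \<and> x = diff_vec d t)"
proof
  assume "x \<in> (\<lambda>x. real k *\<^sub>R x) ` polar_dual d (A_polytope d)"
  then obtain t where "\<forall>i\<le>d. 0 \<le> t i \<and> t i \<le> 1" "x = real k *\<^sub>R diff_vec d t"
    unfolding polar_dual_A_polytope_eq by blast
  then show "\<exists>t. (\<forall>i\<le>d. 0 \<le> t i \<and> t i \<le> real k) \<and> x = diff_vec d t"
    by (intro exI[of _ "\<lambda>i. real k * t i"]) (auto simp: scaleR_diff_vec mult_left_le)
next
  assume "\<exists>t. (\<forall>i\<le>d. 0 \<le> t i \<and> t i \<le> real k) \<and> x = diff_vec d t"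
  then obtain t where t: "\<forall>i\<le>d. 0 \<le> t i \<and> t i \<le> real k" "x = diff_vec d t" by blast
  \<comment> \<open>For \<open>k = 0\<close> the bounds force \<open>t\<close> to vanish on
    \<open>0..d\<close>, so both sides are zero.\<close>
  have "x = real k *\<^sub>R diff_vec d (\<lambda>i. t i / real k)"
    using t by (cases "k = 0") (auto simp: scaleR_diff_vec intro!: diff_vec_cong)
  moreover have "\<forall>i\<le>d. 0 \<le> t i / real k \<and> t i / real k \<le> 1"
    using t(1) by (auto simp: divide_le_eq_1)
  ultimately show "x \<in> (\<lambda>x. real k *\<^sub>R x) ` polar_dual d (A_polytope d)"
    using diff_vec_in_polar_dual_A_polytope[of d "\<lambda>i. t i / real k"] by blast
qed

text \<open>A lattice point of the dilate lifts uniquely to an integer point of \<open>{0..k}^(d+1)\<close> with minimal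
  coordinate \<open>0\<close>.\<close>

lemma lattice_count_polar_dual_A_polytope:
  fixes d k :: nat
  shows "finite (lattice_points d (polar_dual d (A_polytope d)) k)" (is ?fin)
    and "lattice_count d (polar_dual d (A_polytope d)) k = (k + 1) ^ (d + 1) - k ^ (d + 1)" (is ?count)
proof -
  \<comment> \<open>Minimum 0 in the cube \<open>{0..k}\<close> means lying outside
    \<open>{1..k}\<close>, which makes the count a difference of two powers.\<close>
  define T where "T = (PiE {..d} (\<lambda>_. {0..int k})) - (PiE {..d} (\<lambda>_. {1..int k}))"
  define f where "f t = diff_vec d (\<lambda>i. real_of_int (t i))" for t :: "nat \<Rightarrow> int"
  have T_zero: "\<exists>i\<le>d. t i = 0" if "t \<in> T" for t
  proof (rule ccontr)
    assume "\<not> ?thesis"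
    then have "t i \<noteq> 0" if "i \<le> d" for i using that by blast
    moreover have "t \<in> PiE {..d} (\<lambda>_. {0..int k})" using that by (simp add: T_def)
    ultimately have "t \<in> PiE {..d} (\<lambda>_. {1..int k})"
      by (force simp: PiE_iff)
    then show False using that by (simp add: T_def)
  qed
  have T_bounds: "0 \<le> t i \<and> t i \<le> int k" if "t \<in> T" "i \<le> d" for t i
    using that by (auto simp: T_def PiE_iff)
  have image: "lattice_points d (polar_dual d (A_polytope d)) k = f ` T"
  proof (intro equalityI subsetI)
    fix x assume "x \<in> f ` T"
    then obtain t where t: "t \<in> T" "x = f t" by blast
    have "\<forall>i\<le>d. 0 \<le> real_of_int (t i) \<and> real_of_int (t i) \<le> real k"
      using T_bounds[OF t(1)] by (metis of_int_0_le_iff of_int_le_iff of_int_of_nat_eq)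
    then have "x \<in> (\<lambda>x. real k *\<^sub>R x) ` polar_dual d (A_polytope d)"
      unfolding mem_scaled_polar_dual_A_polytope t(2) f_def
      by (intro exI[of _ "\<lambda>i. real_of_int (t i)"] conjI refl)
    moreover have "x \<in> lattice d"
      unfolding t(2) f_def by (rule diff_vec_in_lattice) simp
    ultimately show "x \<in> lattice_points d (polar_dual d (A_polytope d)) k" by (rule IntI)
  next
    fix x assume *: "x \<in> lattice_points d (polar_dual d (A_polytope d)) k"
    then have "x \<in> (\<lambda>x. real k *\<^sub>R x) ` polar_dual d (A_polytope d)" by (rule IntD1)
    then obtain s where s: "\<forall>i\<le>d. 0 \<le> s i \<and> s i \<le> real k" "x = diff_vec d s"
      unfolding mem_scaled_polar_dual_A_polytope by (elim exE conjE)
    \<comment> \<open>The lift \<open>s\<close> may be non-integral and only bounds the spread; the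
      partial sums of a lattice point supply an integral lift.\<close>
    define g where "g i = \<lfloor>partial_sum x i\<rfloor>" for i
    have "partial_sum x i \<in> \<int>" for i
      using * by (auto simp: partial_sum_def lattice_def intro!: Ints_sum)
    then have g: "real_of_int (g i) = partial_sum x i" for i
      by (simp add: g_def)
    define m where "m = Min (g ` {..d})"
    have "m \<in> g ` {..d}" unfolding m_def by (intro Min_in) auto
    then obtain j where j: "j \<le> d" "m = g j" by auto
    have "0 \<le> g i - m \<and> g i - m \<le> int k" if "i \<le> d" for i
    proof
      have "m \<le> g i" unfolding m_def using that by (intro Min_le) auto
      then show "0 \<le> g i - m" by simp
      have "real_of_int (g i - m) = s i - s j"
        using that j by (simp add: g s(2) partial_sum_diff_vec)
      also have "\<dots> \<le> real k" using s(1) that j(1) by (smt (verit))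
      finally show "g i - m \<le> int k" by linarith
    qed
    then have "restrict (\<lambda>i. g i - m) {..d} \<in> T"
      using j unfolding T_def by (auto simp: PiE_iff intro!: bexI[of _ j])
    moreover have "x = f (restrict (\<lambda>i. g i - m) {..d})"
    proof -
      have "x \<in> Rspace d" by (simp add: s(2) diff_vec_in_Rspace)
      then have "x = diff_vec d (\<lambda>i. partial_sum x i - m)" by (simp add: diff_vec_partial_sum)
      also have "\<dots> = f (restrict (\<lambda>i. g i - m) {..d})"
        unfolding f_def by (intro diff_vec_cong) (simp add: g)
      finally show ?thesis .
    qed
    ultimately show "x \<in> f ` T" by blast
  qed
  have "inj_on f T"
  proof (rule inj_onI)
    fix s t assume st: "s \<in> T" "t \<in> T" "f s = f t"
    have diff: "s i - s 0 = t i - t 0" if "i \<le> d" for i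
      using arg_cong[OF st(3), of "\<lambda>x. partial_sum x i"] that
      by (simp add: f_def partial_sum_diff_vec flip: of_int_diff)
    obtain i j where ij: "i \<le> d" "s i = 0" "j \<le> d" "t j = 0"
      using T_zero st(1,2) by meson
    \<comment> \<open>The lifts differ by a constant. A zero of each, compared with the nonnegative
      value of the other there, forces the constant to be 0.\<close>
    then have "s 0 = t 0"
      using diff[of i] diff[of j] T_bounds[OF st(1), of j] T_bounds[OF st(2), of i] by simp
    then have "s i = t i" if "i \<le> d" for i using diff[OF that] by simp
    then show "s = t"
      using st(1,2) by (intro PiE_ext[of s "{..d}" _ t]) (auto simp: T_def)
  qed
  have "finite T" by (auto simp: T_def intro!: finite_Diff finite_PiE)
  then show ?fin unfolding image by simp
  have "card T = (k + 1) ^ (d + 1) - k ^ (d + 1)"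
  proof -
    have "PiE {..d} (\<lambda>_. {1..int k}) \<subseteq> PiE {..d} (\<lambda>_. {0..int k})" by (intro PiE_mono) auto
    then have "card T = card (PiE {..d} (\<lambda>_. {0..int k})) - card (PiE {..d} (\<lambda>_. {1..int k}))"
      unfolding T_def by (intro card_Diff_subset finite_PiE) auto
    then show ?thesis by (simp add: card_PiE nat_add_distrib)
  qed
  then show ?count
    unfolding lattice_count_def image using \<open>inj_on f T\<close> by (simp add: card_image)
qed

subsection \<open>The free sums of the theorem\<close>

text \<open>The properties are carried through one induction because the bipyramid count uses
  convexity, the origin, the ambient space and finiteness. The signed unit vectors are kept in order
  to place the origin in the interior.\<close>

lemma polytope_free_sum:
  fixes n :: nat
  defines "Q \<equiv> \<lambda>n. free_sum 3 (polar_dual 3 (A_polytope 3)) (free_sum_power 1 (polar_dual 1 (A_polytope 1)) n)"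
  shows "convex (Q n) \<and> 0 \<in> Q n \<and> Q n \<subseteq> Rspace (3 + n) \<and>
    (\<forall>i\<in>{1..3 + n}. unit_vec i \<in> Q n \<and> - unit_vec i \<in> Q n) \<and>
    integral_polytope (3 + n) (Q n) \<and> integral_polytope (3 + n) (polar_dual (3 + n) (Q n)) \<and>
    (\<forall>k. finite (lattice_points (3 + n) (Q n) k)) \<and> is_ehrhart_poly (3 + n) (Q n) (ehrhart_poly n)"
proof (induction n)
  case 0
  have Q0: "Q 0 = polar_dual 3 (A_polytope 3)"
    by (simp add: Q_def free_sum_zero convex_polar_dual zero_in_polar_dual)
  have "complex_of_nat ((k + 1) ^ (3 + 1) - k ^ (3 + 1)) = (of_nat k + 1) ^ 4 - of_nat k ^ 4" for k :: nat
    by (subst of_nat_diff) (simp_all add: power_mono add.commute)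
  then have "is_ehrhart_poly 3 (Q 0) (ehrhart_poly 0)"
    unfolding is_ehrhart_poly_def Q0 lattice_count_polar_dual_A_polytope poly_ehrhart_poly_base by simp
  \<comment> \<open>By biduality the polar dual of \<open>Q 0\<close> is
    \<open>A_polytope 3\<close>, whose generators are lattice points.\<close>
  then show ?case
    unfolding Q0 add_0_right
    by (intro conjI ballI allI convex_polar_dual zero_in_polar_dual polar_dual_subset_Rspace
        unit_vec_polar_dual_A_polytope[THEN conjunct1] unit_vec_polar_dual_A_polytope[THEN conjunct2]
        integral_polytope_polar_dual_A_polytope lattice_count_polar_dual_A_polytope(1))
      (simp_all add: polar_dual_polar_dual_A_polytope integral_polytope_A_polytope)
next
  case (Suc n)
  \<comment> \<open>The dual of \<open>A_polytope 1\<close> is a segment, so each further summand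
    adds two apexes.\<close>
  have Q_Suc: "Q (Suc n) = bipyramid (3 + n) (Q n)"
    unfolding Q_def polar_dual_A_polytope_1 by (rule free_sum_power_segment_Suc)
  note IH = Suc[unfolded is_ehrhart_poly_def]
  have "unit_vec i \<in> Q (Suc n) \<and> - unit_vec i \<in> Q (Suc n)" if "i \<in> {1..3 + Suc n}" for i
  proof (cases "i = Suc (3 + n)")
    case True
    show ?thesis unfolding Q_Suc True by (intro conjI unit_vec_bipyramid)
  next
    case False
    then have "i \<in> {1..3 + n}" using that by auto
    then show ?thesis unfolding Q_Suc using Suc subset_bipyramid by blast
  qed
  moreover have "is_ehrhart_poly (3 + Suc n) (Q (Suc n)) (ehrhart_poly (Suc n))"
    unfolding is_ehrhart_poly_def
  proof
    fix k
    have "lattice_count (Suc (3 + n)) (Q (Suc n)) k =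
        lattice_count (3 + n) (Q n) k + 2 * (\<Sum>j<k. lattice_count (3 + n) (Q n) j)"
      unfolding Q_Suc using Suc by (intro lattice_count_bipyramid(2)) auto
    then show "poly (ehrhart_poly (Suc n)) (of_nat k) = of_nat (lattice_count (3 + Suc n) (Q (Suc n)) k)"
      using IH by (simp add: poly_ehrhart_poly_sum)
  qed
  moreover have "finite (lattice_points (Suc (3 + n)) (Q (Suc n)) k)" for k
    unfolding Q_Suc using Suc by (intro lattice_count_bipyramid(1)) auto
  moreover have "0 \<in> Q (Suc n)" "convex (Q (Suc n))"
    unfolding Q_Suc using Suc subset_bipyramid convex_bipyramid by blast+
  moreover have "Q (Suc n) \<subseteq> Rspace (Suc (3 + n))"
    unfolding Q_Suc using Suc by (intro bipyramid_subset_Rspace) simp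
  moreover have "integral_polytope (Suc (3 + n)) (Q (Suc n))"
    unfolding Q_Suc using Suc by (intro integral_polytope_bipyramid) simp
  moreover have "integral_polytope (Suc (3 + n)) (polar_dual (Suc (3 + n)) (Q (Suc n)))"
    unfolding Q_Suc using Suc by (intro integral_polytope_polar_dual_bipyramid) simp_all
  ultimately show ?case by (simp only: add_Suc_right) blast
qed

theorem theorem3:
  fixes n :: nat
  shows "CL_polytope (3 + n)
    (free_sum 3 (polar_dual 3 (A_polytope 3)) (free_sum_power 1 (polar_dual 1 (A_polytope 1)) n))"
  using polytope_free_sum[of n] ehrhart_poly_roots[of n]
  unfolding CL_polytope_def reflexive_def by (blast intro: zero_in_interior)

end
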